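(* Let $\ell$ be a prime, $n\ge1$, $g\ge1$, and let $V$ be a free $\mathbb{Z}/\ell^n\mathbb{Z}$-module of rank $2g$ with a nondegenerate symplectic pairing $\langle\,,\,\rangle_V:V\times V\to\mathbb{Q}/\mathbb{Z}$. Equip the $\ell$-torsion $V[\ell]\subseteq V$ with the induced nondegenerate symplectic pairing $\langle x,y\rangle_{V[\ell]}=\langle x',y\rangle_V$, where $x'\in V$ is any element with $\ell^{n-1}x'=x$. Let $M\subseteq V$ be a maximal isotropic submodule. Then there exists a subgroup $G\subseteq M[\ell]$ which is maximal isotropic in $V[\ell]$ with respect to $\langle\,,\,\rangle_{V[\ell]}$. *)

theory Defs
  imports "HOL-Number_Theory.Residues" "HOL-Algebra.Module" "HOL-Algebra.Coset"
begin

definition rat_mod_int :: "rat set monoid" where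
  "rat_mod_int = \<lparr>carrier = (UNIV :: rat set), monoid.mult = (+), one = 0\<rparr> Mod \<int>"

definition free_module_of_rank ::
    "('a, 'c) ring_scheme \<Rightarrow> ('a, 'b, 'm) module_scheme \<Rightarrow> nat \<Rightarrow> bool" where
  "free_module_of_rank R V r \<longleftrightarrow>
     module R V \<and>
     (\<exists>b \<in> {..<r} \<rightarrow> carrier V. \<forall>v \<in> carrier V.
        \<exists>!c. c \<in> {..<r} \<rightarrow>\<^sub>E carrier R \<and> v = (\<Oplus>\<^bsub>V\<^esub>i\<in>{..<r}. c i \<odot>\<^bsub>V\<^esub> b i))"

definition bilinear_pairing ::
    "('a, 'm) monoid_scheme \<Rightarrow> ('a \<Rightarrow> 'a \<Rightarrow> rat set) \<Rightarrow> bool" where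
  "bilinear_pairing A e \<longleftrightarrow>
     (\<forall>x \<in> carrier A. e x \<in> hom A rat_mod_int) \<and>
     (\<forall>y \<in> carrier A. (\<lambda>x. e x y) \<in> hom A rat_mod_int)"

definition symplectic_pairing ::
    "('a, 'm) monoid_scheme \<Rightarrow> ('a \<Rightarrow> 'a \<Rightarrow> rat set) \<Rightarrow> bool" where
  "symplectic_pairing A e \<longleftrightarrow>
     bilinear_pairing A e \<and> (\<forall>x \<in> carrier A. e x x = \<one>\<^bsub>rat_mod_int\<^esub>)"

definition nondegenerate_pairing ::
    "('a, 'm) monoid_scheme \<Rightarrow> ('a \<Rightarrow> 'a \<Rightarrow> rat set) \<Rightarrow> bool" where
  "nondegenerate_pairing A e \<longleftrightarrow>
     (\<forall>x \<in> carrier A. (\<forall>y \<in> carrier A. e x y = \<one>\<^bsub>rat_mod_int\<^esub>) \<longrightarrow> x = \<one>\<^bsub>A\<^esub>) \<and>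
     (\<forall>y \<in> carrier A. (\<forall>x \<in> carrier A. e x y = \<one>\<^bsub>rat_mod_int\<^esub>) \<longrightarrow> y = \<one>\<^bsub>A\<^esub>)"

definition isotropic :: "('a \<Rightarrow> 'a \<Rightarrow> rat set) \<Rightarrow> 'a set \<Rightarrow> bool" where
  "isotropic e N \<longleftrightarrow> (\<forall>x \<in> N. \<forall>y \<in> N. e x y = \<one>\<^bsub>rat_mod_int\<^esub>)"

text \<open>The family \<open>F\<close> is the set of all subobjects (submodules, or subgroups) of the ambient
  object; maximality is with respect to inclusion.\<close>

definition maximal_isotropic ::
    "'a set set \<Rightarrow> ('a \<Rightarrow> 'a \<Rightarrow> rat set) \<Rightarrow> 'a set \<Rightarrow> bool" where
  "maximal_isotropic F e N \<longleftrightarrow>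
     N \<in> F \<and> isotropic e N \<and> (\<forall>N' \<in> F. isotropic e N' \<and> N \<subseteq> N' \<longrightarrow> N' = N)"

text \<open>\<open>torsion_group V S m\<close> is the additive group \<open>S[m]\<close> for a subgroup \<open>S\<close> of \<open>V\<close>. The factor
  \<open>m\<close> acts as an integer, since it need not be a canonical representative in the scalar ring.\<close>

definition torsion_group ::
    "('a, 'b, 'm) module_scheme \<Rightarrow> 'b set \<Rightarrow> nat \<Rightarrow> 'b monoid" where
  "torsion_group V S m =
     \<lparr>carrier = {x \<in> S. [m] \<cdot>\<^bsub>V\<^esub> x = \<zero>\<^bsub>V\<^esub>}, monoid.mult = (\<oplus>\<^bsub>V\<^esub>), one = \<zero>\<^bsub>V\<^esub>\<rparr>"

text \<open>For \<open>V\<close> free over the integers modulo \<open>l ^ n\<close>, every \<open>x \<in> V[l]\<close> has a preimage under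
  multiplication by \<open>l ^ (n - 1)\<close>, and any two preimages differ by an element of \<open>l V\<close>, which
  pairs trivially with \<open>V[l]\<close>; so on \<open>V[l]\<close> the value does not depend on the choice.\<close>

definition torsion_pairing ::
    "('a, 'b, 'm) module_scheme \<Rightarrow> nat \<Rightarrow> nat \<Rightarrow> ('b \<Rightarrow> 'b \<Rightarrow> rat set) \<Rightarrow> 'b \<Rightarrow> 'b \<Rightarrow> rat set" where
  "torsion_pairing V l n e x y =
     e (SOME x'. x' \<in> carrier V \<and> [(l ^ (n - 1))] \<cdot>\<^bsub>V\<^esub> x' = x) y"

end

theory Submission
  imports Defs "HOL-Algebra.Generated_Groups"
begin

text \<open>
  Maximality gives \<open>M\<^sup>\<bottom> = M\<close>. The subgroup \<open>l\<^sup>n\<^sup>-\<^sup>1 M\<close> of \<open>M[l]\<close> pairs on \<open>V[l]\<close> by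
  \<open>\<langle>l\<^sup>n\<^sup>-\<^sup>1 x, y\<rangle> = \<langle>x, y\<rangle>\<close> (freeness makes \<open>l V\<close> the kernel of \<open>l\<^sup>n\<^sup>-\<^sup>1\<close>, so the choice
  of preimage does not matter), and is therefore isotropic; let \<open>G\<close> be maximal among the isotropic
  subgroups of \<open>M[l]\<close> that contain it. An isotropic subgroup \<open>H \<supseteq> G\<close> of \<open>V[l]\<close> is orthogonal to
  \<open>l\<^sup>n\<^sup>-\<^sup>1 M\<close>, hence \<open>H \<subseteq> M\<^sup>\<bottom> = M\<close> by the same formula, so \<open>H = G\<close>.
\<close>

section \<open>The value group Q/Z\<close>

lemma group_rat_mod_int: "group rat_mod_int"
proof -
  define Q :: "rat monoid" where "Q = \<lparr>carrier = (UNIV :: rat set), monoid.mult = (+), one = 0\<rparr>"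
  have comm: "comm_group Q"
    by (rule comm_groupI) (auto simp: Q_def algebra_simps intro: exI[of _ "- x" for x])
  interpret Q: comm_group Q by (rule comm)
  have inv: "inv\<^bsub>Q\<^esub> x = - x" for x
    by (rule Q.inv_equality) (auto simp: Q_def)
  have "subgroup \<int> Q"
    by (rule Q.subgroupI) (auto simp: inv, auto simp: Q_def)
  then have "\<int> \<lhd> Q"
    by (rule Q.subgroup_imp_normal)
  then show ?thesis
    unfolding rat_mod_int_def Q_def[symmetric] by (rule normal.factorgroup_is_group)
qed

interpretation rat_mod_int: group rat_mod_int
  by (rule group_rat_mod_int)

section \<open>Calculus of pairings with values in Q/Z\<close>

context abelian_group
begin

lemma pairing_closed:
  assumes "bilinear_pairing (add_monoid G) e" "x \<in> carrier G" "y \<in> carrier G"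
  shows "e x y \<in> carrier rat_mod_int"
  using assms unfolding bilinear_pairing_def hom_def by auto

lemma pairing_add_left:
  assumes "bilinear_pairing (add_monoid G) e"
    and "x \<in> carrier G" "x' \<in> carrier G" "y \<in> carrier G"
  shows "e (x \<oplus> x') y = e x y \<otimes>\<^bsub>rat_mod_int\<^esub> e x' y"
  using assms unfolding bilinear_pairing_def hom_def by auto

lemma pairing_add_right:
  assumes "bilinear_pairing (add_monoid G) e"
    and "x \<in> carrier G" "y \<in> carrier G" "y' \<in> carrier G"
  shows "e x (y \<oplus> y') = e x y \<otimes>\<^bsub>rat_mod_int\<^esub> e x y'"
  using assms unfolding bilinear_pairing_def hom_def by auto

lemma pairing_pow_left:
  assumes "bilinear_pairing (add_monoid G) e" "x \<in> carrier G" "y \<in> carrier G"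
  shows "e ([(k::nat)] \<cdot> x) y = e x y [^]\<^bsub>rat_mod_int\<^esub> k"
  using assms hom_nat_pow[of "\<lambda>x. e x y" "add_monoid G" rat_mod_int x k]
    a_group group_rat_mod_int
  unfolding bilinear_pairing_def add_pow_def by simp

lemma pairing_pow_right:
  assumes "bilinear_pairing (add_monoid G) e" "x \<in> carrier G" "y \<in> carrier G"
  shows "e x ([(k::nat)] \<cdot> y) = e x y [^]\<^bsub>rat_mod_int\<^esub> k"
  using assms hom_nat_pow[of "e x" "add_monoid G" rat_mod_int y k]
    a_group group_rat_mod_int
  unfolding bilinear_pairing_def add_pow_def by simp

lemma pairing_pow_swap:
  assumes "bilinear_pairing (add_monoid G) e" "x \<in> carrier G" "y \<in> carrier G"
  shows "e ([(k::nat)] \<cdot> x) y = e x ([k] \<cdot> y)"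
  by (simp add: assms pairing_pow_left pairing_pow_right)

lemma pairing_zero_right:
  assumes "bilinear_pairing (add_monoid G) e" "x \<in> carrier G"
  shows "e x \<zero> = \<one>\<^bsub>rat_mod_int\<^esub>"
  using pairing_pow_right[OF assms zero_closed, of 0] by simp

text \<open>Expanding \<open>e (x \<oplus> y) (x \<oplus> y)\<close> biadditively, the two diagonal
  terms vanish and \<open>e x y\<close> vanishes by assumption, so the remaining term
  \<open>e y x\<close> equals the whole, which is trivial.\<close>

lemma symplectic_orthogonal_sym:
  assumes e: "symplectic_pairing (add_monoid G) e"
    and xy: "x \<in> carrier G" "y \<in> carrier G"
    and orth: "e x y = \<one>\<^bsub>rat_mod_int\<^esub>"
  shows "e y x = \<one>\<^bsub>rat_mod_int\<^esub>"
proof -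
  have b: "bilinear_pairing (add_monoid G) e"
    and alt: "e z z = \<one>\<^bsub>rat_mod_int\<^esub>" if "z \<in> carrier G" for z
    using e that unfolding symplectic_pairing_def by auto
  note b = b[OF xy(1)]
  have "\<one>\<^bsub>rat_mod_int\<^esub> = e (x \<oplus> y) (x \<oplus> y)"
    using alt[of "x \<oplus> y"] xy by simp
  also have "\<dots> = e y x"
    using xy by (simp add: pairing_add_left[OF b] pairing_add_right[OF b] xy[THEN alt] orth
        pairing_closed[OF b])
  finally show ?thesis ..
qed

end

section \<open>Orthogonal complements and generated subgroups\<close>

text \<open>Once orthogonal complements are known to be subgroups, orthogonality passes from a set
  of generators to all that they generate, by minimality of the generated subgroup.\<close>

lemma (in abelian_group) subgroup_orthogonal:
  assumes e: "bilinear_pairing (add_monoid G) e" and Y: "Y \<subseteq> carrier G"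
  shows "subgroup {z \<in> carrier G. \<forall>y\<in>Y. e z y = \<one>\<^bsub>rat_mod_int\<^esub>} (add_monoid G)"
proof (rule add.subgroupI)
  let ?O = "{z \<in> carrier G. \<forall>y\<in>Y. e z y = \<one>\<^bsub>rat_mod_int\<^esub>}"
  have zero: "e \<zero> y = \<one>\<^bsub>rat_mod_int\<^esub>" if "y \<in> Y" for y
    \<comment> \<open>Zero is its own zeroth multiple, so its pairing with \<open>y\<close> is a
      zeroth power.\<close>
    using pairing_pow_left[OF e zero_closed, of y 0] that Y by auto
  then show "?O \<noteq> {}"
    by auto
  show "x \<oplus> y \<in> ?O" if "x \<in> ?O" "y \<in> ?O" for x y
    using that Y by (auto simp: pairing_add_left[OF e] subset_iff)
  show "\<ominus> x \<in> ?O" if x: "x \<in> ?O" for x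
  proof (intro CollectI conjI ballI)
    show "\<ominus> x \<in> carrier G"
      using x by simp
    fix y assume y: "y \<in> Y"
    have "\<one>\<^bsub>rat_mod_int\<^esub> = e (x \<oplus> \<ominus> x) y"
      using x zero[OF y] by (simp add: r_neg)
    also have "\<dots> = e (\<ominus> x) y"
      using x y Y by (auto simp: pairing_add_left[OF e] pairing_closed[OF e] subset_iff)
    finally show "e (\<ominus> x) y = \<one>\<^bsub>rat_mod_int\<^esub>" ..
  qed
qed auto

text \<open>The closure is done one argument at a time. As \<open>A\<close> is orthogonal to itself,
  the generated subgroup is orthogonal to \<open>A\<close>; by symmetry of orthogonality
  \<open>A\<close> lies in the complement of the generated subgroup, and that complement, being a
  subgroup, then contains the generated subgroup as well.\<close>

lemma (in abelian_group) isotropic_generate: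
  assumes e: "symplectic_pairing (add_monoid G) e"
    and A: "A \<subseteq> carrier G" and iso: "isotropic e A"
  shows "isotropic e (generate (add_monoid G) A)"
proof -
  have b: "bilinear_pairing (add_monoid G) e"
    using e unfolding symplectic_pairing_def by blast
  let ?gen = "generate (add_monoid G) A"
  let ?orth = "\<lambda>Y. {z \<in> carrier G. \<forall>y\<in>Y. e z y = \<one>\<^bsub>rat_mod_int\<^esub>}"
  have gen: "?gen \<subseteq> carrier G"
    using add.generate_in_carrier[of A] A by auto
  have "?gen \<subseteq> ?orth A"
    using A iso by (intro add.generate_subgroup_incl subgroup_orthogonal[OF b A])
      (auto simp: isotropic_def)
  then have "A \<subseteq> ?orth ?gen"
    using A gen symplectic_orthogonal_sym[OF e] by (auto simp: subset_iff)
  then have "?gen \<subseteq> ?orth ?gen"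
    by (intro add.generate_subgroup_incl subgroup_orthogonal[OF b gen])
  then show ?thesis
    unfolding isotropic_def by blast
qed

section \<open>Torsion subgroups\<close>

lemma (in abelian_group) subgroup_kernel_pow:
  assumes S: "subgroup S (add_monoid G)"
  shows "subgroup {x \<in> S. [(k::nat)] \<cdot> x = \<zero>} (add_monoid G)"
proof (rule add.subgroupI)
  have sub: "S \<subseteq> carrier G"
    using subgroup.subset[OF S] by simp
  then show "{x \<in> S. [k] \<cdot> x = \<zero>} \<subseteq> carrier G"
    by blast
  show "{x \<in> S. [k] \<cdot> x = \<zero>} \<noteq> {}"
    using subgroup.one_closed[OF S] by auto
  show "\<ominus> x \<in> {x \<in> S. [k] \<cdot> x = \<zero>}" if "x \<in> {x \<in> S. [k] \<cdot> x = \<zero>}" for x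
    using that sub subgroup.m_inv_closed[OF S, of x] add.nat_pow_inv[of x k]
    by (auto simp: a_inv_def)
  show "x \<oplus> y \<in> {x \<in> S. [k] \<cdot> x = \<zero>}"
    if "x \<in> {x \<in> S. [k] \<cdot> x = \<zero>}" "y \<in> {x \<in> S. [k] \<cdot> x = \<zero>}" for x y
    using that sub subgroup.m_closed[OF S, of x y] add.nat_pow_distrib[of x y k]
    by auto
qed

text \<open>\<open>torsion_group\<close> has the operation and unit of \<open>add_monoid V\<close>,
  and inverses depend on nothing else but the carrier. This reduces statements about subgroups of
  M[l] and of V[l] to the same ambient group, where they can be compared.\<close>

lemma subgroup_torsion_group_iff:
  fixes V :: "('a, 'b, 'm) module_scheme"
  assumes V: "abelian_group V" and S: "subgroup S (add_monoid V)"
  shows "subgroup H (torsion_group V S k) \<longleftrightarrow>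
    subgroup H (add_monoid V) \<and> H \<subseteq> S \<and> (\<forall>x\<in>H. [k] \<cdot>\<^bsub>V\<^esub> x = \<zero>\<^bsub>V\<^esub>)"
proof -
  interpret V: abelian_group V by (rule V)
  let ?K = "{x \<in> S. [k] \<cdot>\<^bsub>V\<^esub> x = \<zero>\<^bsub>V\<^esub>}"
  have K: "subgroup ?K (add_monoid V)"
    by (rule V.subgroup_kernel_pow[OF S])
  have "subgroup H (torsion_group V S k) \<longleftrightarrow> subgroup H (add_monoid V\<lparr>carrier := ?K\<rparr>)"
    by (simp add: subgroup_def m_inv_def torsion_group_def)
  also have "\<dots> \<longleftrightarrow> subgroup H (add_monoid V) \<and> H \<subseteq> ?K"
    using group.incl_subgroup[OF V.a_group K, of H] group.subgroup_incl[OF V.a_group _ K, of H]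
      subgroup.subset[of H "add_monoid V\<lparr>carrier := ?K\<rparr>"]
    by auto
  finally show ?thesis by auto
qed

section \<open>Modules over Z/m and self-orthogonality\<close>

locale residue_module = module "residue_ring m" V for m :: int and V (structure) +
  assumes m_gt_one: "m > 1"
begin

lemma residue_ring_simps [simp]:
  "carrier (residue_ring m) = {0..m - 1}"
  "x \<oplus>\<^bsub>residue_ring m\<^esub> y = (x + y) mod m"
  "x \<otimes>\<^bsub>residue_ring m\<^esub> y = (x * y) mod m"
  "\<zero>\<^bsub>residue_ring m\<^esub> = 0"
  "\<one>\<^bsub>residue_ring m\<^esub> = 1"
  by (simp_all add: residue_ring_def)

lemma mod_in_range: "k mod m \<in> {0..m - 1}"
  using m_gt_one pos_mod_bound[of m k] by simp

text \<open>Links the integer action, in which torsion is expressed, with the scalar action. The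
  reduction mod \<open>m\<close> is needed because the scalars are the canonical representatives
  only.\<close>

lemma add_pow_eq_smult:
  assumes "x \<in> carrier V"
  shows "[(k::nat)] \<cdot> x = (int k mod m) \<odot> x"
proof (induction k)
  case 0
  then show ?case
    using smult_l_null[OF assms] by simp
next
  case (Suc k)
  have "(int (Suc k) mod m) \<odot> x = (int k mod m \<oplus>\<^bsub>residue_ring m\<^esub> \<one>\<^bsub>residue_ring m\<^esub>) \<odot> x"
    by (simp add: mod_simps add.commute)
  also have "\<dots> = (int k mod m) \<odot> x \<oplus> x"
    using mod_in_range[of "int k"] R.one_closed smult_one[OF assms] assms
    by (subst smult_l_distr) auto
  finally show ?case
    using Suc by simp
qed

lemma smult_eq_add_pow:
  assumes "c \<in> carrier (residue_ring m)" "x \<in> carrier V"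
  shows "c \<odot> x = [nat c] \<cdot> x"
  using assms by (simp add: add_pow_eq_smult)

text \<open>Every scalar acts as a repeated sum. Hence a generated subgroup is a legitimate
  competitor when \<open>M\<close> is maximal among submodules.\<close>

lemma subgroup_imp_submodule:
  assumes "subgroup H (add_monoid V)"
  shows "submodule H (residue_ring m) V"
proof (rule submodule.intro[OF assms], unfold_locales)
  fix c x assume c: "c \<in> carrier (residue_ring m)" and x: "x \<in> H"
  have "x \<in> carrier V"
    using x subgroup.subset[OF assms] by auto
  moreover have "[k] \<cdot> x \<in> H" for k :: nat
    by (induction k) (use x subgroup.one_closed[OF assms] subgroup.m_closed[OF assms] in auto)
  ultimately show "c \<odot> x \<in> H"
    using c by (simp add: smult_eq_add_pow)
qed

end

text \<open>Adjoining \<open>x\<close> to \<open>M\<close> keeps the set isotropic, because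
  \<open>e x x\<close> is trivial and orthogonality is symmetric. The subgroup generated is then an
  isotropic submodule above \<open>M\<close>, so maximality makes it equal to
  \<open>M\<close>.\<close>

lemma (in residue_module) maximal_isotropic_self_orthogonal:
  assumes e: "symplectic_pairing (add_monoid V) e"
    and M: "maximal_isotropic {N. submodule N (residue_ring m) V} e M"
    and x: "x \<in> carrier V" and orth: "\<And>y. y \<in> M \<Longrightarrow> e y x = \<one>\<^bsub>rat_mod_int\<^esub>"
  shows "x \<in> M"
proof -
  let ?N = "generate (add_monoid V) (insert x M)"
  have MV: "M \<subseteq> carrier V" and iso: "isotropic e M"
    using M submoduleE(1) unfolding maximal_isotropic_def by auto
  have "isotropic e (insert x M)"
    using e x MV orth iso symplectic_orthogonal_sym[OF e _ x]
    unfolding isotropic_def symplectic_pairing_def by (auto simp: subset_iff)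
  then have "isotropic e ?N"
    using x MV by (intro isotropic_generate[OF e]) auto
  moreover have "submodule ?N (residue_ring m) V"
    using x MV by (intro subgroup_imp_submodule add.generate_is_subgroup) auto
  moreover have "insert x M \<subseteq> ?N"
    by (auto intro: generate.incl)
  ultimately show ?thesis
    using M unfolding maximal_isotropic_def by blast
qed

section \<open>Free modules over residue rings: divisibility and finiteness\<close>

text \<open>If \<open>l ^ k\<close> kills \<open>v\<close>, uniqueness of coordinates forces
  \<open>l ^ k\<close> times each coordinate of \<open>v\<close> to be 0 modulo
  \<open>l ^ n\<close>. So each coordinate is divisible by \<open>l ^ (n - k)\<close>, and the
  quotients are coordinates of \<open>w\<close>.\<close>

lemma free_residue_module_kernel_pow:
  fixes l n r k :: nat and V :: "(int, 'v, 'm) module_scheme"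
  assumes l: "l > 1" and n: "n \<ge> 1" and free: "free_module_of_rank (residue_ring (int l ^ n)) V r"
    and k: "k \<le> n" and v: "v \<in> carrier V" and kv: "[(l ^ k)] \<cdot>\<^bsub>V\<^esub> v = \<zero>\<^bsub>V\<^esub>"
  obtains w where "w \<in> carrier V" "v = [(l ^ (n - k))] \<cdot>\<^bsub>V\<^esub> w"
proof -
  let ?m = "int l ^ n" and ?q = "int l ^ (n - k)"
  have m1: "?m > 1"
    using l n by (simp add: one_less_power)
  have mq: "?m = int l ^ k * ?q"
    using k by (simp flip: power_add)
  interpret V: residue_module ?m V
    using free m1 unfolding free_module_of_rank_def residue_module_def residue_module_axioms_def
    by simp
  from free obtain b where b: "b \<in> {..<r} \<rightarrow> carrier V"
    and basis': "\<forall>v \<in> carrier V. \<exists>!c. c \<in> {..<r} \<rightarrow>\<^sub>E carrier (residue_ring ?m) \<and>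
      v = (\<Oplus>\<^bsub>V\<^esub>i\<in>{..<r}. c i \<odot>\<^bsub>V\<^esub> b i)"
    unfolding free_module_of_rank_def by (elim conjE bexE)
  note basis = bspec[OF basis']
  from ex1_implies_ex[OF basis[OF v]] obtain c where c: "c \<in> {..<r} \<rightarrow>\<^sub>E carrier (residue_ring ?m)"
    and vc: "v = (\<Oplus>\<^bsub>V\<^esub>i\<in>{..<r}. c i \<odot>\<^bsub>V\<^esub> b i)"
    by blast
  \<comment> \<open>Integer multiples are computed coordinatewise, with the products reduced so that
    they are again valid coordinates.\<close>
  have pow_sum: "[(j::nat)] \<cdot>\<^bsub>V\<^esub> (\<Oplus>\<^bsub>V\<^esub>i\<in>{..<r}. d i \<odot>\<^bsub>V\<^esub> b i)
      = (\<Oplus>\<^bsub>V\<^esub>i\<in>{..<r}. (int j * d i mod ?m) \<odot>\<^bsub>V\<^esub> b i)"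
    if d: "\<And>i. i < r \<Longrightarrow> d i \<in> {0..?m - 1}" for j d
  proof -
    have db: "(\<lambda>i. d i \<odot>\<^bsub>V\<^esub> b i) \<in> {..<r} \<rightarrow> carrier V"
      using b d by (auto intro!: V.smult_closed)
    have "[j] \<cdot>\<^bsub>V\<^esub> (\<Oplus>\<^bsub>V\<^esub>i\<in>{..<r}. d i \<odot>\<^bsub>V\<^esub> b i)
        = (int j mod ?m) \<odot>\<^bsub>V\<^esub> (\<Oplus>\<^bsub>V\<^esub>i\<in>{..<r}. d i \<odot>\<^bsub>V\<^esub> b i)"
      using db by (intro V.add_pow_eq_smult V.finsum_closed)
    also have "\<dots> = (\<Oplus>\<^bsub>V\<^esub>i\<in>{..<r}. (int j mod ?m) \<odot>\<^bsub>V\<^esub> (d i \<odot>\<^bsub>V\<^esub> b i))"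
      using db V.mod_in_range by (intro V.finsum_smult_ldistr) auto
    also have "\<dots> = (\<Oplus>\<^bsub>V\<^esub>i\<in>{..<r}. (int j * d i mod ?m) \<odot>\<^bsub>V\<^esub> b i)"
    proof (rule V.finsum_cong')
      show "(\<lambda>i. (int j * d i mod ?m) \<odot>\<^bsub>V\<^esub> b i) \<in> {..<r} \<rightarrow> carrier V"
        using b V.mod_in_range by (auto intro!: V.smult_closed)
      fix i assume "i \<in> {..<r}"
      then show "(int j mod ?m) \<odot>\<^bsub>V\<^esub> (d i \<odot>\<^bsub>V\<^esub> b i) = (int j * d i mod ?m) \<odot>\<^bsub>V\<^esub> b i"
        using V.smult_assoc1[of "int j mod ?m" "d i" "b i"] b d[of i] V.mod_in_range[of "int j"]
        by (auto simp: mod_mult_left_eq Pi_iff)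
    qed simp
    finally show ?thesis .
  qed
  have cr: "c i \<in> {0..?m - 1}" if "i < r" for i
    using c that by (auto simp: PiE_iff)
  have "c i mod ?q = 0" if i: "i < r" for i
  proof -
    \<comment> \<open>Two coordinate vectors of zero. Uniqueness is stated for functions that are
      \<open>undefined\<close> outside \<open>{..<r}\<close>, so both are restricted before being
      compared.\<close>
    let ?d = "\<lambda>i\<in>{..<r}. int l ^ k * c i mod ?m" and ?z = "\<lambda>i\<in>{..<r}. 0 :: int"
    have sum_d: "\<zero>\<^bsub>V\<^esub> = (\<Oplus>\<^bsub>V\<^esub>i\<in>{..<r}. ?d i \<odot>\<^bsub>V\<^esub> b i)"
    proof -
      have "\<zero>\<^bsub>V\<^esub> = (\<Oplus>\<^bsub>V\<^esub>i\<in>{..<r}. (int l ^ k * c i mod ?m) \<odot>\<^bsub>V\<^esub> b i)"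
        using kv pow_sum[of c "l ^ k"] cr by (simp add: vc)
      also have "\<dots> = (\<Oplus>\<^bsub>V\<^esub>i\<in>{..<r}. ?d i \<odot>\<^bsub>V\<^esub> b i)"
        using b V.mod_in_range by (intro V.finsum_cong') (auto intro!: V.smult_closed)
      finally show ?thesis .
    qed
    have sum_z: "\<zero>\<^bsub>V\<^esub> = (\<Oplus>\<^bsub>V\<^esub>i\<in>{..<r}. ?z i \<odot>\<^bsub>V\<^esub> b i)"
    proof -
      have "(\<Oplus>\<^bsub>V\<^esub>i\<in>{..<r}. ?z i \<odot>\<^bsub>V\<^esub> b i) = (\<Oplus>\<^bsub>V\<^esub>i\<in>{..<r}. \<zero>\<^bsub>V\<^esub>)"
        using b V.smult_l_null by (intro V.finsum_cong') auto
      then show ?thesis by simp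
    qed
    have "?d = ?z"
    proof (rule ex1E[OF basis[OF V.zero_closed]])
      fix c0 assume uniq: "\<forall>c'. c' \<in> {..<r} \<rightarrow>\<^sub>E carrier (residue_ring ?m) \<and>
          \<zero>\<^bsub>V\<^esub> = (\<Oplus>\<^bsub>V\<^esub>i\<in>{..<r}. c' i \<odot>\<^bsub>V\<^esub> b i) \<longrightarrow> c' = c0"
      have "?d \<in> {..<r} \<rightarrow>\<^sub>E carrier (residue_ring ?m)"
        unfolding V.residue_ring_simps by (intro restrict_PiE_iff[THEN iffD2] ballI V.mod_in_range)
      moreover have "?z \<in> {..<r} \<rightarrow>\<^sub>E carrier (residue_ring ?m)"
        using l by (auto simp: restrict_PiE_iff)
      ultimately show "?d = ?z"
        using uniq sum_d sum_z by metis
    qed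
    then have "int l ^ k * c i mod ?m = 0"
      using i by (auto dest: fun_cong[of _ _ i])
    \<comment> \<open>As \<open>?m\<close> is \<open>int l ^ k * ?q\<close>, the residue is
      \<open>int l ^ k\<close> times \<open>c i mod ?q\<close>, and the nonzero factor
      cancels.\<close>
    then show ?thesis
      using l by (simp add: mq)
  qed
  \<comment> \<open>The division by \<open>?q\<close> is exact, and the product \<open>c i\<close>
    is already reduced modulo \<open>?m\<close>.\<close>
  then have cq: "?q * (c i div ?q) mod ?m = c i" if "i < r" for i
    using cr[OF that] that mult_div_mod_eq[of ?q "c i"] by auto
  have dr: "c i div ?q \<in> {0..?m - 1}" if "i < r" for i
  proof -
    have "?q > 0" using l by simp
    then have "c i div ?q \<le> c i"
      using cr[OF that] zdiv_mono2[of "c i" 1 ?q] by auto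
    then show ?thesis
      using cr[OF that] \<open>?q > 0\<close> by (auto simp: pos_imp_zdiv_nonneg_iff)
  qed
  let ?w = "\<Oplus>\<^bsub>V\<^esub>i\<in>{..<r}. (c i div ?q) \<odot>\<^bsub>V\<^esub> b i"
  have "?w \<in> carrier V"
    using b dr by (intro V.finsum_closed) (auto intro!: V.smult_closed)
  moreover have "[(l ^ (n - k))] \<cdot>\<^bsub>V\<^esub> ?w = v"
  proof -
    have "[(l ^ (n - k))] \<cdot>\<^bsub>V\<^esub> ?w = (\<Oplus>\<^bsub>V\<^esub>i\<in>{..<r}. (?q * (c i div ?q) mod ?m) \<odot>\<^bsub>V\<^esub> b i)"
      using pow_sum[of "\<lambda>i. c i div ?q" "l ^ (n - k)"] dr by simp
    also have "\<dots> = v"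
      unfolding vc using b cr cq by (intro V.finsum_cong') (auto intro!: V.smult_closed)
    finally show ?thesis .
  qed
  ultimately show thesis
    using that by blast
qed

text \<open>There are only finitely many coordinate vectors. Finiteness later yields a maximal
  element in a family of subgroups.\<close>

lemma free_residue_module_finite:
  assumes "free_module_of_rank (residue_ring m) V r"
  shows "finite (carrier V)"
proof -
  from assms obtain b where "\<forall>v \<in> carrier V. \<exists>!c. c \<in> {..<r} \<rightarrow>\<^sub>E carrier (residue_ring m) \<and>
      v = (\<Oplus>\<^bsub>V\<^esub>i\<in>{..<r}. c i \<odot>\<^bsub>V\<^esub> b i)"
    unfolding free_module_of_rank_def by blast
  then have "carrier V \<subseteq> (\<lambda>c. \<Oplus>\<^bsub>V\<^esub>i\<in>{..<r}. c i \<odot>\<^bsub>V\<^esub> b i) ` ({..<r} \<rightarrow>\<^sub>E carrier (residue_ring m))"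
    by blast
  then show ?thesis
    by (rule finite_subset) (auto simp: residue_ring_def intro!: finite_PiE)
qed

section \<open>The induced pairing on V[l]\<close>

text \<open>The chosen preimage and \<open>x\<close> differ by some \<open>z\<close> killed by
  \<open>l ^ (n - 1)\<close>. By freeness \<open>z\<close> is \<open>l\<close> times some
  \<open>w\<close>, and the factor \<open>l\<close> moves across the pairing to kill
  \<open>y\<close>.\<close>

lemma torsion_pairing_pow:
  fixes l n r :: nat and V :: "(int, 'v, 'm) module_scheme"
  assumes l: "l > 1" and n: "n \<ge> 1"
    and free: "free_module_of_rank (residue_ring (int l ^ n)) V r"
    and e: "bilinear_pairing (add_monoid V) e"
    and x: "x \<in> carrier V" and y: "y \<in> carrier V" "[l] \<cdot>\<^bsub>V\<^esub> y = \<zero>\<^bsub>V\<^esub>"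
  shows "torsion_pairing V l n e ([(l ^ (n - 1))] \<cdot>\<^bsub>V\<^esub> x) y = e x y"
proof -
  interpret V: module "residue_ring (int l ^ n)" V
    using free unfolding free_module_of_rank_def by blast
  let ?P = "\<lambda>x'. x' \<in> carrier V \<and> [(l ^ (n - 1))] \<cdot>\<^bsub>V\<^esub> x' = [(l ^ (n - 1))] \<cdot>\<^bsub>V\<^esub> x"
  define x' where "x' = (SOME x'. ?P x')"
  have "?P x'"
    unfolding x'_def by (rule someI[of ?P x]) (simp add: x)
  then have x': "x' \<in> carrier V" and eq: "[(l ^ (n - 1))] \<cdot>\<^bsub>V\<^esub> x' = [(l ^ (n - 1))] \<cdot>\<^bsub>V\<^esub> x"
    by auto
  let ?z = "x' \<oplus>\<^bsub>V\<^esub> \<ominus>\<^bsub>V\<^esub> x"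
  have z: "?z \<in> carrier V"
    using x x' by simp
  have "[(l ^ (n - 1))] \<cdot>\<^bsub>V\<^esub> ?z = \<zero>\<^bsub>V\<^esub>"
    using x x' by (simp add: V.add.nat_pow_distrib V.add.nat_pow_inv eq[simplified] V.r_neg)
  \<comment> \<open>Here \<open>k\<close> is \<open>n - 1\<close>, and \<open>n - (n - 1)\<close> is
    1 because \<open>n \<ge> 1\<close>; this leaves exactly one factor \<open>l\<close>.\<close>
  from free_residue_module_kernel_pow[OF l n free _ z this]
  obtain w where w: "w \<in> carrier V" "?z = [l] \<cdot>\<^bsub>V\<^esub> w"
    using n by auto
  have "e x' y = e (?z \<oplus>\<^bsub>V\<^esub> x) y"
    using x x' by (simp add: V.a_assoc V.l_neg)
  also have "\<dots> = e ?z y \<otimes>\<^bsub>rat_mod_int\<^esub> e x y"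
    by (rule V.pairing_add_left[OF e z x y(1)])
  also have "e ?z y = e w ([l] \<cdot>\<^bsub>V\<^esub> y)"
    unfolding w(2) by (rule V.pairing_pow_swap[OF e w(1) y(1)])
  also have "\<dots> = \<one>\<^bsub>rat_mod_int\<^esub>"
    using V.pairing_zero_right[OF e w(1)] y(2) by simp
  finally show ?thesis
    using V.pairing_closed[OF e x y(1)] unfolding torsion_pairing_def x'_def by simp
qed

lemma (in abelian_group) subgroup_image_pow:
  assumes S: "subgroup S (add_monoid G)"
  shows "subgroup ((\<lambda>x. [(k::nat)] \<cdot> x) ` S) (add_monoid G)"
proof (rule add.subgroupI)
  have sub: "S \<subseteq> carrier G"
    using subgroup.subset[OF S] by simp
  then show "(\<lambda>x. [k] \<cdot> x) ` S \<subseteq> carrier G"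
    by auto
  show "(\<lambda>x. [k] \<cdot> x) ` S \<noteq> {}"
    using subgroup.one_closed[OF S] by auto
  fix y assume "y \<in> (\<lambda>x. [k] \<cdot> x) ` S"
  then obtain a where a: "a \<in> S" "y = [k] \<cdot> a"
    by blast
  then show "\<ominus> y \<in> (\<lambda>x. [k] \<cdot> x) ` S"
    using sub subgroup.m_inv_closed[OF S a(1)] add.nat_pow_inv[of a k]
    by (intro image_eqI[of _ _ "\<ominus> a"]) (auto simp: a_inv_def)
  fix z assume "z \<in> (\<lambda>x. [k] \<cdot> x) ` S"
  then obtain b where b: "b \<in> S" "z = [k] \<cdot> b"
    by blast
  then show "y \<oplus> z \<in> (\<lambda>x. [k] \<cdot> x) ` S"
    using a subsetD[OF sub a(1)] subsetD[OF sub b(1)] subgroup.m_closed[OF S a(1) b(1)]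
    by (intro image_eqI[of _ _ "a \<oplus> b"]) (simp_all add: add.nat_pow_distrib)
qed

section \<open>Construction of \<open>G\<close> inside M[l] and its maximality in V[l]\<close>

theorem theorem6p14:
  fixes l n g :: nat
    and V :: "(int, 'v, 'm) module_scheme"
    and e :: "'v \<Rightarrow> 'v \<Rightarrow> rat set"
    and M :: "'v set"
  assumes "prime l" and "n \<ge> 1" and "g \<ge> 1"
    and "free_module_of_rank (residue_ring (int l ^ n)) V (2 * g)"
    and "symplectic_pairing (add_monoid V) e"
    and "nondegenerate_pairing (add_monoid V) e"
    and "maximal_isotropic {N. submodule N (residue_ring (int l ^ n)) V} e M"
  shows "\<exists>G. subgroup G (torsion_group V M l) \<and>
             maximal_isotropic {H. subgroup H (torsion_group V (carrier V) l)}
               (torsion_pairing V l n e) G"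
proof -
  note n = assms(2) and free = assms(4) and sympl = assms(5) and M = assms(7)
  let ?t = "torsion_pairing V l n e" and ?q = "l ^ (n - 1)"
  have l: "l > 1"
    using assms(1) prime_gt_1_nat by blast
  interpret V: residue_module "int l ^ n" V
    using free l n
    unfolding free_module_of_rank_def residue_module_def residue_module_axioms_def
    by (simp add: one_less_power)
  have e: "bilinear_pairing (add_monoid V) e"
    using sympl unfolding symplectic_pairing_def by blast
  have subM: "subgroup M (add_monoid V)" and isoM: "isotropic e M"
    using M submodule.axioms(1) unfolding maximal_isotropic_def by auto
  have MV: "M \<subseteq> carrier V"
    using subgroup.subset[OF subM] by simp
  have subV: "subgroup (carrier V) (add_monoid V)"
    using V.add.subgroup_self by simp
  note torsion_M = subgroup_torsion_group_iff[OF V.abelian_group_axioms subM]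
  note torsion_V = subgroup_torsion_group_iff[OF V.abelian_group_axioms subV]
  have t: "?t ([?q] \<cdot>\<^bsub>V\<^esub> x) y = e x y"
    if "x \<in> carrier V" "y \<in> carrier V" "[l] \<cdot>\<^bsub>V\<^esub> y = \<zero>\<^bsub>V\<^esub>" for x y
    by (rule torsion_pairing_pow[OF l n free e that])
  let ?L = "(\<lambda>x. [?q] \<cdot>\<^bsub>V\<^esub> x) ` M"
  \<comment> \<open>Competitors are taken inside \<open>M\<close> only; maximality among all
    isotropic subgroups of V[l] is recovered at the end by forcing a larger \<open>H\<close> into
    \<open>M\<close>.\<close>
  let ?F = "{H. subgroup H (torsion_group V M l) \<and> isotropic ?t H}"
  have L_M: "?L \<subseteq> M"
  proof
    fix y assume "y \<in> ?L"
    then obtain x where x: "x \<in> M" "y = [?q] \<cdot>\<^bsub>V\<^esub> x" by blast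
    have "[k] \<cdot>\<^bsub>V\<^esub> x \<in> M" for k :: nat
      by (induction k) (use x subgroup.one_closed[OF subM] subgroup.m_closed[OF subM] in auto)
    then show "y \<in> M" using x by simp
  qed
  have L_torsion: "[l] \<cdot>\<^bsub>V\<^esub> y = \<zero>\<^bsub>V\<^esub>" if "y \<in> ?L" for y
  proof -
    from that obtain x where x: "x \<in> carrier V" "y = [?q] \<cdot>\<^bsub>V\<^esub> x"
      using MV by blast
    \<comment> \<open>The factors combine to \<open>l ^ n\<close> since \<open>n \<ge> 1\<close>,
      and \<open>l ^ n\<close> is the zero scalar.\<close>
    have "[l] \<cdot>\<^bsub>V\<^esub> y = [(l ^ n)] \<cdot>\<^bsub>V\<^esub> x"
      using x n by (simp add: V.add.nat_pow_pow power_eq_if mult.commute)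
    also have "\<dots> = \<zero>\<^bsub>V\<^esub>"
      using V.smult_l_null[OF x(1)] by (simp add: V.add_pow_eq_smult[OF x(1)])
    finally show ?thesis .
  qed
  have L: "?L \<in> ?F"
  proof (intro CollectI conjI)
    show "subgroup ?L (torsion_group V M l)"
      using V.subgroup_image_pow[OF subM] L_M L_torsion unfolding torsion_M by blast
    \<comment> \<open>By \<open>t\<close> the value is \<open>e x y\<close>, and \<open>y\<close>
      lies in \<open>M\<close> along with \<open>x\<close>, so isotropy of \<open>M\<close>
      applies.\<close>
    have "?t ([?q] \<cdot>\<^bsub>V\<^esub> x) y = \<one>\<^bsub>rat_mod_int\<^esub>" if "x \<in> M" "y \<in> ?L" for x y
      using that t[of x y] L_M MV L_torsion isoM unfolding isotropic_def by blast
    then show "isotropic ?t ?L"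
      unfolding isotropic_def by blast
  qed
  have "?F \<subseteq> Pow (carrier V)"
    using MV unfolding torsion_M by blast
  then have "finite ?F"
    using free_residue_module_finite[OF free] finite_subset by blast
  then have "\<exists>G\<in>?F. ?L \<subseteq> G \<and> (\<forall>H\<in>?F. G \<subseteq> H \<longrightarrow> G = H)"
    using L by (rule finite_has_maximal2)
  then obtain G where G: "G \<in> ?F" "?L \<subseteq> G" and G_max: "\<forall>H\<in>?F. G \<subseteq> H \<longrightarrow> G = H"
    by (elim bexE conjE)
  have "maximal_isotropic {H. subgroup H (torsion_group V (carrier V) l)} ?t G"
    unfolding maximal_isotropic_def
  proof (intro conjI ballI impI; (elim conjE)?)
    show "G \<in> {H. subgroup H (torsion_group V (carrier V) l)}" "isotropic ?t G"
      using G(1) MV unfolding torsion_M torsion_V by auto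
    fix H assume H: "H \<in> {H. subgroup H (torsion_group V (carrier V) l)}"
      and iso: "isotropic ?t H" and GH: "G \<subseteq> H"
    have "h \<in> M" if h: "h \<in> H" for h
    proof (rule V.maximal_isotropic_self_orthogonal[OF sympl M])
      have hV: "h \<in> carrier V" "[l] \<cdot>\<^bsub>V\<^esub> h = \<zero>\<^bsub>V\<^esub>"
        using h H unfolding torsion_V by auto
      then show "h \<in> carrier V" by simp
      fix y assume y: "y \<in> M"
      \<comment> \<open>The multiple of \<open>y\<close> lies in \<open>?L\<close>, hence in
        \<open>H\<close> together with \<open>h\<close>. Through \<open>t\<close>, orthogonality to
        \<open>?L\<close> under the induced pairing becomes orthogonality to all of \<open>M\<close>
        under \<open>e\<close>.\<close>
      then have "?t ([?q] \<cdot>\<^bsub>V\<^esub> y) h = \<one>\<^bsub>rat_mod_int\<^esub>"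
        using iso h G(2) GH unfolding isotropic_def by blast
      then show "e y h = \<one>\<^bsub>rat_mod_int\<^esub>"
        using t[of y h] y MV hV by auto
    qed
    then have "H \<in> ?F"
      using H iso unfolding torsion_M torsion_V by auto
    then show "H = G"
      using G_max GH by blast
  qed
  then show ?thesis
    using G(1) by blast
qed

end
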